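(* Fix any clustering instance $\mathcal V=(V,d,k)$ with $|V|=n$ and let $\vec Z\sim\mathrm{Uniform}([0,1]^k)$. Then: (1) For any parameter interval $[\alpha_\ell,\alpha_h]$ with $\alpha_\ell>0$, the expected number of discontinuities of the function $\alpha\mapsto\mathtt{seed}_\alpha(\mathcal V,\vec Z)$ on $[\alpha_\ell,\alpha_h]$ is at most $O(nk\log(n)\log(\alpha_h/\alpha_\ell))$. (2) For any parameter interval $[0,\alpha_h]$, the expected number of discontinuities of $\alpha\mapsto\mathtt{seed}_\alpha(\mathcal V,\vec Z)$ on $[0,\alpha_h]$ is at most $O(nk\log(n)\log(\alpha_h\log R))$, where $R$ is the largest ratio between any pair of non-zero distances in $\mathcal V$.
   Context: A clustering instance $\mathcal V=(V,d,k)$ consists of a finite point set $V$, $|V|=n$, a metric $d$, and $1\le k\le n$. For $C\subseteq V$, $d_{\min}(v,C)=\min_{c\in C}d(v,c)$. For $\alpha\in[0,\infty)$ and $\vec Z=(z_1,\dots,z_k)\in[0,1]^k$, the deterministic $d^\alpha$-seeding procedure starts with $C=\emptyset$ and for $t=1,\dots,k$: order the points $v_1,\dots,v_n$ so that $d_i=d_{\min}(v_i,C)$ satisfies $d_1\ge\dots\ge d_n$ (in round 1 all points get equal weight), let $D_i(\alpha)=\sum_{j=1}^i d_j^\alpha$ (points at distance 0 get weight 0), partition $[0,1]$ into intervals $I_{v_i}=[D_{i-1}(\alpha)/D_n(\alpha),D_i(\alpha)/D_n(\alpha))$, and add to $C$ the point whose interval contains $z_t$. $\mathtt{seed}_\alpha(\mathcal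 V,\vec Z)$ is the resulting sequence of $k$ centers. A discontinuity of this (piecewise constant) function of $\alpha$ is a value of $\alpha$ at which the output changes.
   Formalization: In (2), the factor log(α_h log R) is replaced by max(δ, log(α_h log R)) for arbitrary δ>0, with the O-constant depending on δ, because the literal bound fails when α_h log R is at most 1 or close to 1. *)

theory Defs
  imports "HOL-Probability.Probability"
begin

locale clustering_instance = Metric_space V d
  for V :: "'a set" and d :: "'a \<Rightarrow> 'a \<Rightarrow> real" +
  fixes k :: nat
  assumes finite_points: "finite V"
    and k_pos: "1 \<le> k"
    and k_le: "k \<le> card V"

definition dist_min :: "('a \<Rightarrow> 'a \<Rightarrow> real) \<Rightarrow> 'a list \<Rightarrow> 'a \<Rightarrow> real" where
  "dist_min d C v = (MIN c\<in>set C. d v c)"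

text \<open>
  An arrangement assigns to each sequence of already chosen centers an enumeration of the points
  by decreasing distance to these centers.  It is a parameter of the seeding procedure, so that
  nothing is assumed about how ties are broken, nor about the enumeration used in the first round,
  except that this does not depend on the exponent.
\<close>

definition is_arrangement :: "'a set \<Rightarrow> ('a \<Rightarrow> 'a \<Rightarrow> real) \<Rightarrow> ('a list \<Rightarrow> 'a list) \<Rightarrow> bool" where
  "is_arrangement V d arr \<longleftrightarrow>
     (\<forall>C. set C \<subseteq> V \<longrightarrow>
        distinct (arr C) \<and> set (arr C) = V \<and>
        (C \<noteq> [] \<longrightarrow> sorted_wrt (\<lambda>u v. dist_min d C u \<ge> dist_min d C v) (arr C)))"

text \<open>
  Since \<^term>\<open>(0::real) powr a = 0\<close> for every exponent, also for \<^term>\<open>a = (0::real)\<close>, points at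
  distance 0 get weight 0 throughout.
\<close>

definition weight :: "('a \<Rightarrow> 'a \<Rightarrow> real) \<Rightarrow> real \<Rightarrow> 'a list \<Rightarrow> 'a \<Rightarrow> real" where
  "weight d \<alpha> C v = (if C = [] then 1 else dist_min d C v powr \<alpha>)"

definition cum_weight ::
  "('a list \<Rightarrow> 'a list) \<Rightarrow> ('a \<Rightarrow> 'a \<Rightarrow> real) \<Rightarrow> real \<Rightarrow> 'a list \<Rightarrow> nat \<Rightarrow> real" where
  "cum_weight arr d \<alpha> C i = (\<Sum>j<i. weight d \<alpha> C (arr C ! j))"

text \<open>List positions start at 0, so position \<^term>\<open>i\<close> holds the point of index \<^term>\<open>i + 1\<close>.\<close>

definition seed_interval ::
  "('a list \<Rightarrow> 'a list) \<Rightarrow> ('a \<Rightarrow> 'a \<Rightarrow> real) \<Rightarrow> real \<Rightarrow> 'a list \<Rightarrow> nat \<Rightarrow> real set" where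
  "seed_interval arr d \<alpha> C i =
     (let n = length (arr C)
      in {cum_weight arr d \<alpha> C i / cum_weight arr d \<alpha> C n ..<
          cum_weight arr d \<alpha> C (Suc i) / cum_weight arr d \<alpha> C n})"

text \<open>
  The half-open intervals are disjoint and cover \<^term>\<open>{0..<1::real}\<close>.  The fallback to a farthest
  point concerns, within the unit interval, only \<^term>\<open>z = (1::real)\<close>, an event of probability 0.
\<close>

definition next_center ::
  "('a list \<Rightarrow> 'a list) \<Rightarrow> ('a \<Rightarrow> 'a \<Rightarrow> real) \<Rightarrow> real \<Rightarrow> real \<Rightarrow> 'a list \<Rightarrow> 'a" where
  "next_center arr d \<alpha> z C =
     (if \<exists>i<length (arr C). z \<in> seed_interval arr d \<alpha> C i
      then arr C ! (THE i. i < length (arr C) \<and> z \<in> seed_interval arr d \<alpha> C i)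
      else hd (arr C))"

primrec seed ::
  "('a list \<Rightarrow> 'a list) \<Rightarrow> ('a \<Rightarrow> 'a \<Rightarrow> real) \<Rightarrow> nat \<Rightarrow> real \<Rightarrow> (nat \<Rightarrow> real) \<Rightarrow> 'a list" where
  "seed arr d 0 \<alpha> Z = []"
| "seed arr d (Suc t) \<alpha> Z =
     seed arr d t \<alpha> Z @ [next_center arr d \<alpha> (Z t) (seed arr d t \<alpha> Z)]"

definition uniform_cube :: "nat \<Rightarrow> (nat \<Rightarrow> real) measure" where
  "uniform_cube k = (\<Pi>\<^sub>M t\<in>{..<k}. uniform_measure lborel {0..1})"

text \<open>
  Outputs carry the discrete topology: a point of \<^term>\<open>S\<close> is a discontinuity iff the function is
  not constant on any neighbourhood of it in \<^term>\<open>S\<close>.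
\<close>

definition discontinuities :: "(real \<Rightarrow> 'b) \<Rightarrow> real set \<Rightarrow> real set" where
  "discontinuities f S =
     {\<alpha>\<in>S. \<not> topcontinuous_at (top_of_set S) (discrete_topology UNIV) f \<alpha>}"

text \<open>Infinite sets of discontinuities are counted as \<^term>\<open>\<infinity> :: ennreal\<close>.\<close>

definition num_discontinuities :: "(real \<Rightarrow> 'b) \<Rightarrow> real set \<Rightarrow> ennreal" where
  "num_discontinuities f S = emeasure (count_space UNIV) (discontinuities f S)"

definition max_dist_ratio :: "'a set \<Rightarrow> ('a \<Rightarrow> 'a \<Rightarrow> real) \<Rightarrow> real" where
  "max_dist_ratio V d =
     Max {d x y / d u v | x y u v.
            x \<in> V \<and> y \<in> V \<and> u \<in> V \<and> v \<in> V \<and> d x y \<noteq> 0 \<and> d u v \<noteq> 0}"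

text \<open>
  \<open>expected_at_most M X b\<close>: the expectation of \<^term>\<open>X\<close> is well defined and at most \<^term>\<open>b\<close>.
  Measurability is part of it because the nonnegative integral of a non-measurable function is only
  a lower integral.
\<close>

definition expected_at_most :: "'z measure \<Rightarrow> ('z \<Rightarrow> ennreal) \<Rightarrow> real \<Rightarrow> bool" where
  "expected_at_most M X b \<longleftrightarrow> X \<in> borel_measurable M \<and> (\<integral>\<^sup>+ z. X z \<partial>M) \<le> ennreal b"

end

theory Submission
  imports Defs
begin

text \<open>
  Write \<open>F\<^sub>i(\<alpha>)\<close> for \<open>D\<^sub>i(\<alpha>) / D\<^sub>n(\<alpha>)\<close>.  Given the previous centers, the next one is determined by which of
  the inequalities \<open>F\<^sub>i(\<alpha>) \<le> z\<close> hold, and each \<open>F\<^sub>i\<close> is continuous and nondecreasing because the points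
  are sorted by decreasing distance.  Hence the output is left continuous in \<open>\<alpha>\<close> with right limits, so
  the number of its discontinuities is the limit of the number of changes between neighbouring points
  of finer and finer grids.  By Fatou's lemma it suffices to bound the probability that the outputs
  for \<open>\<alpha> \<le> \<beta>\<close> differ by a quantity that telescopes along a grid.  Seeding with \<open>\<alpha>\<close> and \<open>\<beta>\<close> differs for
  the first time in a given round with probability at most the sum of \<open>F\<^sub>i(\<beta>) - F\<^sub>i(\<alpha>)\<close> over \<open>0 < i < n\<close>.
  The derivative of \<open>F\<^sub>i\<close> is at most \<open>ln n / \<alpha>\<close>, by an entropy bound, and at most \<open>ln R\<close>; the first bound
  gives part (1), and part (2) uses the second one up to \<open>1 / ln R\<close> and the first one beyond.
\<close>

subsection \<open>Ratios of power sums of a decreasing sequence\<close>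

text \<open>At base \<open>0\<close> the power is constantly \<open>0\<close>, also at exponent
  \<open>0\<close>, so differentiating weights needs no exception for zero distances.\<close>

lemma has_real_derivative_powr_exponent:
  fixes x :: real
  assumes "x \<ge> 0"
  shows "((\<lambda>\<alpha>. x powr \<alpha>) has_real_derivative x powr \<alpha> * ln x) (at \<alpha>)"
proof (cases "x = 0")
  case False
  then show ?thesis
    using assms by (auto intro!: derivative_eq_intros)
qed simp

text \<open>\<open>x\<close> stands for the distances to the chosen centers in the order of an
  arrangement. Then \<open>W i\<close> is \<open>D\<^sub>i\<close> and \<open>W' i\<close> is its
  derivative in the exponent.\<close>

locale decreasing_nonneg =
  fixes x :: "nat \<Rightarrow> real" and n :: nat
  assumes nonneg: "j < n \<Longrightarrow> 0 \<le> x j"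
    and decreasing: "i \<le> j \<Longrightarrow> j < n \<Longrightarrow> x j \<le> x i"
begin

definition W :: "nat \<Rightarrow> real \<Rightarrow> real" where
  "W i \<alpha> = (\<Sum>j<i. x j powr \<alpha>)"

definition W' :: "nat \<Rightarrow> real \<Rightarrow> real" where
  "W' i \<alpha> = (\<Sum>j<i. x j powr \<alpha> * ln (x j))"

lemma W_nonneg: "0 \<le> W i \<alpha>"
  unfolding W_def by (intro sum_nonneg) simp

lemma W_mono: "i \<le> j \<Longrightarrow> W i \<alpha> \<le> W j \<alpha>"
  unfolding W_def by (intro sum_mono2) auto

lemma W_has_derivative:
  assumes "i \<le> n"
  shows "(W i has_real_derivative W' i \<alpha>) (at \<alpha>)"
  unfolding W_def[abs_def] W'_def
  using assms by (intro DERIV_sum has_real_derivative_powr_exponent nonneg) auto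

text \<open>The right-hand side is free of \<open>\<alpha>\<close>: the total weight vanishes for
  all exponents or for none. If it vanishes, every ratio is \<open>0\<close> by the convention on
  division.\<close>

lemma W_pos_iff: "0 < W n \<alpha> \<longleftrightarrow> (\<exists>j<n. x j \<noteq> 0)"
proof -
  have "W n \<alpha> = 0 \<longleftrightarrow> (\<forall>j<n. x j = 0)"
    unfolding W_def by (subst sum_nonneg_eq_0_iff) auto
  then show ?thesis using W_nonneg[of n \<alpha>] by (auto simp: less_le)
qed

lemma ratio_has_derivative:
  assumes "i \<le> n" "\<exists>j<n. x j \<noteq> 0"
  shows "((\<lambda>\<alpha>. W i \<alpha> / W n \<alpha>) has_real_derivative
           (W' i \<alpha> * W n \<alpha> - W i \<alpha> * W' n \<alpha>) / (W n \<alpha> * W n \<alpha>)) (at \<alpha>)"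
  using W_has_derivative[OF assms(1)] W_has_derivative[OF order_refl] assms(2) W_pos_iff[of \<alpha>]
  by (intro DERIV_divide) auto

lemma ratio_eq_0: "\<not> (\<exists>j<n. x j \<noteq> 0) \<Longrightarrow> W i \<alpha> / W n \<alpha> = 0"
  using W_pos_iff[of \<alpha>] W_nonneg[of n \<alpha>] by (metis division_ring_divide_zero less_le)

section \<open>Sign and size of the derivative of the ratios\<close>

lemma derivative_numerator_eq:
  "W' i \<alpha> * W m \<alpha> - W i \<alpha> * W' m \<alpha> =
     (\<Sum>j<i. \<Sum>l<m. x j powr \<alpha> * x l powr \<alpha> * (ln (x j) - ln (x l)))"
  unfolding W_def W'_def sum_product sum_subtractf[symmetric]
  by (intro sum.cong refl) (simp add: algebra_simps)

text \<open>Pairs with both members in the prefix cancel. Each remaining pair takes \<open>j\<close>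
  from the prefix and \<open>l\<close> from the tail, so that \<open>x l \<le> x j\<close>.\<close>

lemma derivative_numerator_nonneg:
  assumes "i \<le> n"
  shows "0 \<le> W' i \<alpha> * W n \<alpha> - W i \<alpha> * W' n \<alpha>"
proof -
  have split: "sum f {..<n} = sum f {..<i} + sum f {i..<n}" for f :: "nat \<Rightarrow> real"
    using assms by (metis atLeast0LessThan sum.atLeastLessThan_concat zero_le)
  have "W' i \<alpha> * W n \<alpha> - W i \<alpha> * W' n \<alpha> =
      W' i \<alpha> * (\<Sum>j=i..<n. x j powr \<alpha>) - W i \<alpha> * (\<Sum>j=i..<n. x j powr \<alpha> * ln (x j))"
    unfolding W_def[of n] W'_def[of n] split unfolding W_def W'_def by (simp add: algebra_simps)
  also have "\<dots> = (\<Sum>j<i. \<Sum>l=i..<n. x j powr \<alpha> * x l powr \<alpha> * (ln (x j) - ln (x l)))"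
    unfolding W_def W'_def sum_product sum_subtractf[symmetric]
    by (intro sum.cong refl) (simp add: algebra_simps)
  also have "0 \<le> \<dots>"
  proof (intro sum_nonneg)
    fix j l assume "j \<in> {..<i}" "l \<in> {i..<n}"
    then have "0 \<le> x l" "x l \<le> x j" using nonneg decreasing by auto
    then show "0 \<le> x j powr \<alpha> * x l powr \<alpha> * (ln (x j) - ln (x l))"
      by (cases "x l = 0") auto
  qed
  finally show ?thesis .
qed

text \<open>Each difference of logarithms is the logarithm of a ratio of non-zero entries; pairs
  with a zero entry contribute \<open>0\<close> on both sides.\<close>

lemma derivative_numerator_le_ratio:
  assumes "i \<le> n" and R: "\<And>j l. j < n \<Longrightarrow> l < n \<Longrightarrow> x j \<noteq> 0 \<Longrightarrow> x l \<noteq> 0 \<Longrightarrow> x j / x l \<le> R"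
  shows "W' i \<alpha> * W n \<alpha> - W i \<alpha> * W' n \<alpha> \<le> W i \<alpha> * W n \<alpha> * ln R"
proof -
  have "W' i \<alpha> * W n \<alpha> - W i \<alpha> * W' n \<alpha> \<le> (\<Sum>j<i. \<Sum>l<n. x j powr \<alpha> * x l powr \<alpha> * ln R)"
    unfolding derivative_numerator_eq
  proof (intro sum_mono)
    fix j l assume "j \<in> {..<i}" "l \<in> {..<n}"
    then have jl: "j < n" "l < n" using assms(1) by auto
    show "x j powr \<alpha> * x l powr \<alpha> * (ln (x j) - ln (x l)) \<le> x j powr \<alpha> * x l powr \<alpha> * ln R"
    proof (cases "x j = 0 \<or> x l = 0")
      case False
      then have pos: "0 < x j" "0 < x l" using nonneg jl by (auto simp: less_le)
      have "ln (x j) - ln (x l) = ln (x j / x l)" using pos by (simp add: ln_div)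
      also have "\<dots> \<le> ln R" using pos R[OF jl] False by (intro ln_mono) auto
      finally show ?thesis by (intro mult_left_mono) auto
    qed auto
  qed
  also have "\<dots> = W i \<alpha> * W n \<alpha> * ln R"
    unfolding W_def sum_product by (simp add: sum_distrib_right)
  finally show ?thesis .
qed

text \<open>
  After multiplication by \<open>\<alpha>\<close> the logarithms are those of the weights themselves.  The upper bound
  for the prefix uses that no weight exceeds the total; the lower bound for the total is the
  maximality of the entropy of the uniform distribution.
\<close>

lemma derivative_numerator_le_entropy:
  assumes "i \<le> n" "\<exists>j<n. x j \<noteq> 0"
  shows "\<alpha> * (W' i \<alpha> * W n \<alpha> - W i \<alpha> * W' n \<alpha>) \<le> W i \<alpha> * W n \<alpha> * ln n"
proof -
  define D where "D = W n \<alpha>"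
  have D: "0 < D" unfolding D_def using W_pos_iff assms by auto
  have n: "0 < n" using assms by auto
  have "\<alpha> * W' i \<alpha> \<le> (\<Sum>j<i. x j powr \<alpha> * ln D)"
    unfolding W'_def sum_distrib_left
  proof (intro sum_mono)
    fix j assume j: "j \<in> {..<i}"
    show "\<alpha> * (x j powr \<alpha> * ln (x j)) \<le> x j powr \<alpha> * ln D"
    proof (cases "x j = 0")
      case False
      then have pos: "0 < x j" using nonneg[of j] assms j by (auto simp: less_le)
      have "x j powr \<alpha> \<le> D" unfolding D_def W_def
        using j assms by (intro member_le_sum) auto
      then have "ln (x j powr \<alpha>) \<le> ln D" using pos by (intro ln_mono) auto
      then have "x j powr \<alpha> * (\<alpha> * ln (x j)) \<le> x j powr \<alpha> * ln D"
        using pos by (intro mult_left_mono) (auto simp: ln_powr)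
      then show ?thesis by (simp add: algebra_simps)
    qed simp
  qed
  then have upper: "\<alpha> * W' i \<alpha> \<le> W i \<alpha> * ln D"
    by (simp add: W_def sum_distrib_right)
  \<comment> \<open>The corrections \<open>- D / n + x j powr \<alpha>\<close> sum to
    \<open>0\<close>. They come from \<open>ln t \<le> t - 1\<close> at
    \<open>t = D / n / w\<close>, the average weight divided by the \<open>j\<close>-th one.\<close>
  have "(\<Sum>j<n. x j powr \<alpha> * ln (D / n) - D / n + x j powr \<alpha>) \<le> \<alpha> * W' n \<alpha>"
    unfolding W'_def sum_distrib_left
  proof (intro sum_mono)
    fix j assume j: "j \<in> {..<n}"
    show "x j powr \<alpha> * ln (D / n) - D / n + x j powr \<alpha> \<le> \<alpha> * (x j powr \<alpha> * ln (x j))"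
    proof (cases "x j = 0")
      case False
      then have pos: "0 < x j" using nonneg[of j] assms j by (auto simp: less_le)
      define w where "w = x j powr \<alpha>"
      have w: "0 < w" "ln w = \<alpha> * ln (x j)" using pos by (auto simp: w_def ln_powr)
      have "ln (D / n) - ln w = ln (D / n / w)" using D n w by (simp add: ln_div ln_mult)
      also have "\<dots> \<le> D / n / w - 1" using D n w by (intro ln_le_minus_one) auto
      finally have "w * (ln (D / n) - ln w) \<le> w * (D / n / w - 1)"
        using w by (intro mult_left_mono) auto
      also have "\<dots> = D / n - w" using w n by (simp add: field_simps)
      finally show ?thesis unfolding w_def[symmetric] using w(2) by (simp add: algebra_simps)
    qed (use D n in simp)
  qed
  moreover have "(\<Sum>j<n. x j powr \<alpha> * ln (D / n) - D / n + x j powr \<alpha>) = D * ln (D / n)"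
    using n by (simp add: sum.distrib sum_subtractf sum_distrib_right[symmetric] D_def W_def)
  ultimately have lower: "D * ln (D / n) \<le> \<alpha> * W' n \<alpha>" by simp
  have "\<alpha> * W' i \<alpha> * D \<le> W i \<alpha> * ln D * D"
    using upper D by (intro mult_right_mono) auto
  moreover have "W i \<alpha> * (D * ln (D / n)) \<le> W i \<alpha> * (\<alpha> * W' n \<alpha>)"
    using lower W_nonneg by (intro mult_left_mono) auto
  moreover have "ln (D / n) = ln D - ln n" using D n by (simp add: ln_div)
  ultimately show ?thesis unfolding D_def[symmetric] by (simp add: algebra_simps)
qed

section \<open>Monotonicity, continuity and increments of the ratios\<close>

lemma ratio_mono:
  assumes "i \<le> n" "\<alpha> \<le> \<beta>"
  shows "W i \<alpha> / W n \<alpha> \<le> W i \<beta> / W n \<beta>"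
proof (cases "\<exists>j<n. x j \<noteq> 0")
  case True
  show ?thesis
    by (rule DERIV_nonneg_imp_nondecreasing[OF assms(2)])
       (metis ratio_has_derivative[OF assms(1) True] derivative_numerator_nonneg[OF assms(1)]
          divide_nonneg_nonneg zero_le_square)
qed (simp add: ratio_eq_0)

lemma isCont_ratio:
  assumes "i \<le> n"
  shows "isCont (\<lambda>\<alpha>. W i \<alpha> / W n \<alpha>) \<alpha>"
proof (cases "\<exists>j<n. x j \<noteq> 0")
  case True
  then show ?thesis using DERIV_isCont ratio_has_derivative[OF assms] by blast
qed (simp add: ratio_eq_0)

text \<open>The derivative bound is integrated by showing that \<open>g\<close> minus the ratio is
  nondecreasing. \<open>B\<close> and \<open>h\<close> will be \<open>ln n\<close> and
  \<open>inverse\<close> for the logarithmic bound, \<open>ln R\<close> and the constant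
  \<open>1\<close> for the linear one.\<close>

lemma ratio_diff_le:
  assumes "i \<le> n" "\<alpha> \<le> \<beta>" "\<exists>j<n. x j \<noteq> 0" "0 \<le> B"
    and g: "\<And>\<gamma>. \<alpha> \<le> \<gamma> \<Longrightarrow> \<gamma> \<le> \<beta> \<Longrightarrow> (g has_real_derivative B * h \<gamma>) (at \<gamma>)"
    and h: "\<And>\<gamma>. \<alpha> \<le> \<gamma> \<Longrightarrow> \<gamma> \<le> \<beta> \<Longrightarrow> 0 \<le> h \<gamma> \<and>
              W' i \<gamma> * W n \<gamma> - W i \<gamma> * W' n \<gamma> \<le> W i \<gamma> * W n \<gamma> * B * h \<gamma>"
  shows "W i \<beta> / W n \<beta> - W i \<alpha> / W n \<alpha> \<le> g \<beta> - g \<alpha>"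
proof -
  have "g \<alpha> - W i \<alpha> / W n \<alpha> \<le> g \<beta> - W i \<beta> / W n \<beta>"
  proof (rule DERIV_nonneg_imp_nondecreasing[OF assms(2)], intro exI conjI)
    fix \<gamma> assume \<gamma>: "\<alpha> \<le> \<gamma>" "\<gamma> \<le> \<beta>"
    let ?r' = "(W' i \<gamma> * W n \<gamma> - W i \<gamma> * W' n \<gamma>) / (W n \<gamma> * W n \<gamma>)"
    show "((\<lambda>\<alpha>. g \<alpha> - W i \<alpha> / W n \<alpha>) has_real_derivative (B * h \<gamma> - ?r')) (at \<gamma>)"
      using g[OF \<gamma>] ratio_has_derivative[OF assms(1,3)] by (intro DERIV_diff)
    have D: "0 < W n \<gamma>" using W_pos_iff assms by auto
    have "W' i \<gamma> * W n \<gamma> - W i \<gamma> * W' n \<gamma> \<le> W i \<gamma> * W n \<gamma> * (B * h \<gamma>)"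
      using h[OF \<gamma>] by (simp add: mult.assoc)
    \<comment> \<open>The ratio \<open>W i \<gamma> / W n \<gamma>\<close> is estimated by
      \<open>1\<close>.\<close>
    also have "\<dots> \<le> W n \<gamma> * W n \<gamma> * (B * h \<gamma>)"
      using h[OF \<gamma>] assms(4) D W_mono[OF assms(1)] by (intro mult_right_mono) auto
    finally have "?r' \<le> B * h \<gamma>"
      using D by (simp add: pos_divide_le_eq mult.commute)
    then show "0 \<le> B * h \<gamma> - ?r'" by simp
  qed
  then show ?thesis by simp
qed

lemma ratio_diff_le_ln:
  assumes "i \<le> n" "0 < \<alpha>" "\<alpha> \<le> \<beta>"
  shows "W i \<beta> / W n \<beta> - W i \<alpha> / W n \<alpha> \<le> ln n * ln \<beta> - ln n * ln \<alpha>"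
proof (cases "\<exists>j<n. x j \<noteq> 0")
  case True
  then have n: "0 \<le> ln (real n)" by (cases n) auto
  show ?thesis
  proof (rule ratio_diff_le[OF assms(1,3) True n, where h = inverse and g = "\<lambda>\<beta>. ln n * ln \<beta>"])
    fix \<gamma> assume "\<alpha> \<le> \<gamma>" "\<gamma> \<le> \<beta>"
    then have \<gamma>: "0 < \<gamma>" using assms by simp
    show "((\<lambda>\<beta>. ln n * ln \<beta>) has_real_derivative ln n * inverse \<gamma>) (at \<gamma>)"
      using \<gamma> by (auto intro!: derivative_eq_intros simp: field_simps)
    show "0 \<le> inverse \<gamma> \<and>
        W' i \<gamma> * W n \<gamma> - W i \<gamma> * W' n \<gamma> \<le> W i \<gamma> * W n \<gamma> * ln n * inverse \<gamma>"
      using derivative_numerator_le_entropy[OF assms(1) True, of \<gamma>] \<gamma> by (simp add: field_simps)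
  qed
next
  case False
  \<comment> \<open>For \<open>n = 0\<close> both sides are \<open>0\<close>, because
    \<open>ln 0 = 0\<close>.\<close>
  have "ln n * ln \<alpha> \<le> ln n * ln \<beta>" using assms by (cases n) (auto intro!: mult_left_mono)
  then show ?thesis by (simp add: ratio_eq_0[OF False])
qed

lemma ratio_diff_le_linear:
  assumes "i \<le> n" "\<alpha> \<le> \<beta>" "1 \<le> R"
    and R: "\<And>j l. j < n \<Longrightarrow> l < n \<Longrightarrow> x j \<noteq> 0 \<Longrightarrow> x l \<noteq> 0 \<Longrightarrow> x j / x l \<le> R"
  shows "W i \<beta> / W n \<beta> - W i \<alpha> / W n \<alpha> \<le> ln R * \<beta> - ln R * \<alpha>"
proof (cases "\<exists>j<n. x j \<noteq> 0")
  case True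
  show ?thesis
  proof (rule ratio_diff_le[OF assms(1,2) True, where h = "\<lambda>_. 1" and B = "ln R"])
    fix \<gamma>
    show "((*) (ln R) has_real_derivative ln R * 1) (at \<gamma>)"
      by (auto intro!: derivative_eq_intros)
    show "0 \<le> (1::real) \<and> W' i \<gamma> * W n \<gamma> - W i \<gamma> * W' n \<gamma> \<le> W i \<gamma> * W n \<gamma> * ln R * 1"
      using derivative_numerator_le_ratio[OF assms(1) R] by simp
  qed (use assms in simp)
next
  case False
  then show ?thesis using assms by (simp add: ratio_eq_0 mult_left_mono)
qed

end


subsection \<open>Counting discontinuities along grids\<close>

text \<open>In the discrete topology \<open>{g \<alpha>}\<close> is open, so continuity at a point
  of \<open>S\<close> is constancy near it in \<open>S\<close>. The filter form suits one-sided
  limits.\<close>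

lemma mem_discontinuities_iff:
  "\<alpha> \<in> discontinuities g S \<longleftrightarrow> \<alpha> \<in> S \<and> \<not> (\<forall>\<^sub>F y in at \<alpha> within S. g y = g \<alpha>)"
proof (cases "\<alpha> \<in> S")
  case True
  have "topcontinuous_at (top_of_set S) (discrete_topology UNIV) g \<alpha> \<longleftrightarrow>
      (\<exists>U. openin (top_of_set S) U \<and> \<alpha> \<in> U \<and> (\<forall>y\<in>U. g y = g \<alpha>))"
  proof
    assume "topcontinuous_at (top_of_set S) (discrete_topology UNIV) g \<alpha>"
    then have "\<forall>V. openin (discrete_topology UNIV) V \<and> g \<alpha> \<in> V \<longrightarrow>
        (\<exists>U. openin (top_of_set S) U \<and> \<alpha> \<in> U \<and> (\<forall>y\<in>U. g y \<in> V))"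
      unfolding topcontinuous_at_def by blast
    from this[rule_format, of "{g \<alpha>}"]
    show "\<exists>U. openin (top_of_set S) U \<and> \<alpha> \<in> U \<and> (\<forall>y\<in>U. g y = g \<alpha>)" by auto
  next
    assume "\<exists>U. openin (top_of_set S) U \<and> \<alpha> \<in> U \<and> (\<forall>y\<in>U. g y = g \<alpha>)"
    then obtain U where "openin (top_of_set S) U" "\<alpha> \<in> U" "\<forall>y\<in>U. g y = g \<alpha>" by blast
    then have "\<exists>U. openin (top_of_set S) U \<and> \<alpha> \<in> U \<and> (\<forall>y\<in>U. g y \<in> T)" if "g \<alpha> \<in> T" for T
      using that by metis
    then show "topcontinuous_at (top_of_set S) (discrete_topology UNIV) g \<alpha>"
      unfolding topcontinuous_at_def using True by simp
  qed
  also have "\<dots> \<longleftrightarrow> (\<forall>\<^sub>F y in at \<alpha> within S. g y = g \<alpha>)"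
  proof
    assume "\<exists>U. openin (top_of_set S) U \<and> \<alpha> \<in> U \<and> (\<forall>y\<in>U. g y = g \<alpha>)"
    then show "\<forall>\<^sub>F y in at \<alpha> within S. g y = g \<alpha>"
      unfolding eventually_at_topological openin_open by blast
  next
    assume "\<forall>\<^sub>F y in at \<alpha> within S. g y = g \<alpha>"
    then obtain T where "open T" "\<alpha> \<in> T" "\<forall>y\<in>T. y \<noteq> \<alpha> \<longrightarrow> y \<in> S \<longrightarrow> g y = g \<alpha>"
      unfolding eventually_at_topological by blast
    then show "\<exists>U. openin (top_of_set S) U \<and> \<alpha> \<in> U \<and> (\<forall>y\<in>U. g y = g \<alpha>)"
      using True by (intro exI[of _ "S \<inter> T"]) auto
  qed
  finally show ?thesis unfolding discontinuities_def using True by simp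
qed (simp add: discontinuities_def)

text \<open>
  One-sided limits together with left continuity, for the discrete topology on the range.  At a
  discontinuity of such a function the value differs from the right limit, so that a grid cell
  containing it has different values at its two ends once the grid is fine enough.
\<close>

definition left_step :: "(real \<Rightarrow> 'b) \<Rightarrow> bool" where
  "left_step g \<longleftrightarrow>
     (\<forall>\<alpha>. (\<forall>\<^sub>F y in at_left \<alpha>. g y = g \<alpha>) \<and> (\<exists>c. \<forall>\<^sub>F y in at_right \<alpha>. g y = c))"

definition grid :: "real \<Rightarrow> real \<Rightarrow> nat \<Rightarrow> nat \<Rightarrow> real" where
  "grid a b m i = a + (b - a) * (real i / real m)"

definition grid_changes :: "(real \<Rightarrow> 'b) \<Rightarrow> real \<Rightarrow> real \<Rightarrow> nat \<Rightarrow> nat set" where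
  "grid_changes g a b m = {i. i < m \<and> g (grid a b m i) \<noteq> g (grid a b m (Suc i))}"

lemma grid_mono: "a \<le> b \<Longrightarrow> i \<le> j \<Longrightarrow> grid a b m i \<le> grid a b m j"
  unfolding grid_def by (intro add_left_mono mult_left_mono divide_right_mono) auto

lemma grid_0: "grid a b m 0 = a"
  by (simp add: grid_def)

lemma grid_end: "0 < m \<Longrightarrow> grid a b m m = b"
  by (simp add: grid_def)

lemma grid_step: "grid a b m (Suc i) = grid a b m i + (b - a) / real m"
  by (simp add: grid_def add_divide_distrib ring_distribs)

text \<open>At \<open>b\<close> only the approach from the left counts, and there \<open>g\<close>
  is continuous. Elsewhere a right limit equal to \<open>g \<alpha>\<close> would make
  \<open>g\<close> constant on both sides of \<open>\<alpha>\<close>.\<close>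

lemma discontinuity_right_limit:
  assumes g: "left_step g" and \<alpha>: "\<alpha> \<in> discontinuities g {a..b}"
  obtains c where "a \<le> \<alpha>" "\<alpha> < b" "c \<noteq> g \<alpha>" "\<forall>\<^sub>F y in at_right \<alpha>. g y = c"
proof -
  obtain c where c: "\<forall>\<^sub>F y in at_right \<alpha>. g y = c" and l: "\<forall>\<^sub>F y in at_left \<alpha>. g y = g \<alpha>"
    using g unfolding left_step_def by blast
  have ab: "a \<le> \<alpha>" "\<alpha> \<le> b" and d: "\<not> (\<forall>\<^sub>F y in at \<alpha> within {a..b}. g y = g \<alpha>)"
    using \<alpha> unfolding mem_discontinuities_iff by auto
  have "c \<noteq> g \<alpha>"
  proof
    assume "c = g \<alpha>"
    then have "\<forall>\<^sub>F y in at \<alpha>. g y = g \<alpha>" using c l by (simp add: eventually_at_split)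
    then show False using d at_le[of "{a..b}" UNIV \<alpha>] by (auto simp: le_filter_def)
  qed
  moreover have "\<alpha> \<noteq> b"
  proof
    assume "\<alpha> = b"
    then have "at \<alpha> within {a..b} \<le> at_left \<alpha>"
      unfolding at_within_def by (intro inf_mono order_refl) auto
    then show False using d l by (auto simp: le_filter_def)
  qed
  ultimately show thesis using that ab c by auto
qed

text \<open>Once the mesh is below the lengths on which \<open>g\<close> is constant to the left and
  to the right of \<open>\<alpha>\<close>, the ends of the cell around \<open>\<alpha>\<close> carry
  the values \<open>g \<alpha>\<close> and the right limit.\<close>

lemma discontinuity_in_grid_cell:
  assumes g: "left_step g" and \<alpha>: "\<alpha> \<in> discontinuities g {a..b}"
  shows "\<forall>\<^sub>F m in sequentially. \<exists>i \<in> grid_changes g a b m.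
           grid a b m i \<le> \<alpha> \<and> \<alpha> < grid a b m (Suc i)"
proof -
  obtain c where ab: "a \<le> \<alpha>" "\<alpha> < b" and c: "c \<noteq> g \<alpha>" "\<forall>\<^sub>F y in at_right \<alpha>. g y = c"
    using discontinuity_right_limit[OF assms] .
  obtain u where u: "u < \<alpha>" "\<And>y. u < y \<Longrightarrow> y < \<alpha> \<Longrightarrow> g y = g \<alpha>"
    using g unfolding left_step_def eventually_at_left_field by blast
  obtain v where v: "\<alpha> < v" "\<And>y. \<alpha> < y \<Longrightarrow> y < v \<Longrightarrow> g y = c"
    using c(2) unfolding eventually_at_right_field by blast
  have "(\<lambda>m. (b - a) / real m) \<longlonglongrightarrow> 0"
    by (intro real_tendsto_divide_at_top[OF tendsto_const] filterlim_real_sequentially)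
  then have "\<forall>\<^sub>F m in sequentially. (b - a) / real m < min (\<alpha> - u) (v - \<alpha>)"
    using u(1) v(1) by (intro order_tendstoD(2)) auto
  then show ?thesis
    using eventually_gt_at_top[of 0]
  proof eventually_elim
    case (elim m)
    \<comment> \<open>The index of the cell containing \<open>\<alpha>\<close>; cells are closed on
      the left, so the left end may be \<open>\<alpha>\<close> itself.\<close>
    define i where "i = nat \<lfloor>(\<alpha> - a) / (b - a) * m\<rfloor>"
    have nn: "0 \<le> (\<alpha> - a) / (b - a) * m" using ab by simp
    have "real i \<le> (\<alpha> - a) / (b - a) * m" "(\<alpha> - a) / (b - a) * m < real i + 1"
      unfolding i_def using nn by linarith+
    then have lo: "grid a b m i \<le> \<alpha>" and up: "\<alpha> < grid a b m (Suc i)"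
      using ab elim unfolding grid_def by (simp_all add: field_simps)
    have "\<not> m \<le> i" using grid_mono[of a b m i m] grid_end[of m a b] ab lo elim by auto
    moreover have "g (grid a b m i) = g \<alpha>"
      using u(2)[of "grid a b m i"] lo up elim grid_step[of a b m i] by (cases "grid a b m i = \<alpha>") auto
    moreover have "g (grid a b m (Suc i)) = c"
      using v(2)[of "grid a b m (Suc i)"] lo up elim grid_step[of a b m i] by auto
    ultimately have "i \<in> grid_changes g a b m" using c(1) unfolding grid_changes_def by auto
    then show ?case using lo up by blast
  qed
qed

lemma finite_grid_changes: "finite (grid_changes g a b m)"
  unfolding grid_changes_def by simp

text \<open>Once the mesh is smaller than all gaps in \<open>A\<close>, distinct elements lie in
  distinct cells. Taking a finite \<open>A\<close> covers infinitely many discontinuities as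
  well.\<close>

lemma card_le_grid_changes:
  assumes g: "left_step g" and A: "finite A" "A \<subseteq> discontinuities g {a..b}"
  shows "\<forall>\<^sub>F m in sequentially. card A \<le> card (grid_changes g a b m)"
proof -
  have mesh: "(\<lambda>m. (b - a) / real m) \<longlonglongrightarrow> 0"
    by (intro real_tendsto_divide_at_top[OF tendsto_const] filterlim_real_sequentially)
  have "\<forall>\<^sub>F m in sequentially. \<forall>\<alpha>\<in>A. \<exists>i \<in> grid_changes g a b m.
           grid a b m i \<le> \<alpha> \<and> \<alpha> < grid a b m (Suc i)"
    using A discontinuity_in_grid_cell[OF g] by (intro eventually_ball_finite) auto
  moreover have "\<forall>\<^sub>F m in sequentially. \<forall>\<alpha>\<in>A. \<forall>\<beta>\<in>A. \<alpha> \<noteq> \<beta> \<longrightarrow> (b - a) / real m < \<bar>\<alpha> - \<beta>\<bar>"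
  proof (intro eventually_ball_finite ballI A)
    fix \<alpha> \<beta>
    show "\<forall>\<^sub>F m in sequentially. \<alpha> \<noteq> \<beta> \<longrightarrow> (b - a) / real m < \<bar>\<alpha> - \<beta>\<bar>"
      by (cases "\<alpha> = \<beta>") (auto intro: order_tendstoD(2)[OF mesh])
  qed
  ultimately show ?thesis
  proof eventually_elim
    case (elim m)
    then obtain h where h: "\<And>\<alpha>. \<alpha> \<in> A \<Longrightarrow> h \<alpha> \<in> grid_changes g a b m"
      "\<And>\<alpha>. \<alpha> \<in> A \<Longrightarrow> grid a b m (h \<alpha>) \<le> \<alpha> \<and> \<alpha> < grid a b m (Suc (h \<alpha>))"
      by metis
    have "inj_on h A"
    proof (rule inj_onI, rule ccontr)
      fix \<alpha> \<beta> assume *: "\<alpha> \<in> A" "\<beta> \<in> A" "h \<alpha> = h \<beta>" "\<alpha> \<noteq> \<beta>"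
      then show False
        using h(2)[of \<alpha>] h(2)[of \<beta>] grid_step[of a b m "h \<alpha>"] elim(2)[rule_format, of \<alpha> \<beta>] by auto
    qed
    then show ?case
      using h(1) finite_grid_changes by (intro card_inj_on_le) auto
  qed
qed

text \<open>Without a discontinuity in the half-open cell, \<open>g\<close> would be locally
  constant on the closed cell, hence constant by connectedness. Choosing one discontinuity per
  changed cell is injective because half-open cells are disjoint.\<close>

lemma grid_changes_le:
  assumes g: "left_step g" and ab: "a \<le> b"
  shows "ennreal (card (grid_changes g a b m)) \<le> num_discontinuities g {a..b}"
proof -
  let ?D = "discontinuities g {a..b}"
  have "\<exists>\<xi>\<in>?D. grid a b m i \<le> \<xi> \<and> \<xi> < grid a b m (Suc i)" if i: "i \<in> grid_changes g a b m" for i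
  proof (rule ccontr)
    let ?u = "grid a b m i" and ?v = "grid a b m (Suc i)"
    assume no: "\<not> ?thesis"
    have m: "0 < m" "i < m" using i by (auto simp: grid_changes_def)
    have sub: "a \<le> ?u" "?u \<le> ?v" "?v \<le> b"
      using grid_mono[OF ab, of 0 i m] grid_mono[OF ab, of i "Suc i" m]
        grid_mono[OF ab, of "Suc i" m m] m by (auto simp: grid_0 grid_end)
    have "\<forall>\<^sub>F y in at \<xi> within {?u..?v}. g \<xi> = g y" if \<xi>: "\<xi> \<in> {?u..?v}" for \<xi>
    \<comment> \<open>The right end may be a discontinuity, but within the cell it is approached
      only from the left.\<close>
    proof (cases "\<xi> = ?v")
      case True
      then have "at \<xi> within {?u..?v} \<le> at_left \<xi>"
        unfolding at_within_def by (intro inf_mono order_refl) auto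
      moreover have "\<forall>\<^sub>F y in at_left \<xi>. g \<xi> = g y"
        using g unfolding left_step_def by (auto simp: eq_commute)
      ultimately show ?thesis by (auto simp: le_filter_def)
    next
      case False
      then have "\<xi> \<notin> ?D" using no \<xi> by auto
      then have "\<forall>\<^sub>F y in at \<xi> within {a..b}. g \<xi> = g y"
        using \<xi> sub unfolding mem_discontinuities_iff by (auto simp: eq_commute)
      moreover have "at \<xi> within {?u..?v} \<le> at \<xi> within {a..b}"
        using sub by (intro at_le) auto
      ultimately show ?thesis by (auto simp: le_filter_def)
    qed
    then have "g ?u = g ?v"
      using sub by (intro connected_local_const[where A = "{?u..?v}"]) auto
    then show False using i by (simp add: grid_changes_def)
  qed
  then obtain h where h: "\<And>i. i \<in> grid_changes g a b m \<Longrightarrow> h i \<in> ?D"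
    "\<And>i. i \<in> grid_changes g a b m \<Longrightarrow> grid a b m i \<le> h i \<and> h i < grid a b m (Suc i)"
    by metis
  have "inj_on h (grid_changes g a b m)"
  proof (rule inj_onI, rule ccontr)
    fix i j assume *: "i \<in> grid_changes g a b m" "j \<in> grid_changes g a b m" "h i = h j" "i \<noteq> j"
    have "Suc i \<le> j \<or> Suc j \<le> i" using *(4) by auto
    then show False
      using grid_mono[OF ab, of "Suc i" j m] grid_mono[OF ab, of "Suc j" i m] h(2)[OF *(1)]
        h(2)[OF *(2)] *(3) by auto
  qed
  then have "card (grid_changes g a b m) = card (h ` grid_changes g a b m)"
    by (simp add: card_image)
  then have "ennreal (card (grid_changes g a b m)) =
      emeasure (count_space UNIV) (h ` grid_changes g a b m)"
    using finite_grid_changes[of g a b m]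
    by (simp add: emeasure_count_space_finite ennreal_of_nat_eq_real_of_nat)
  also have "\<dots> \<le> emeasure (count_space UNIV) ?D"
    using h(1) by (intro emeasure_mono) auto
  finally show ?thesis unfolding num_discontinuities_def .
qed

text \<open>Equality, not only an upper bound, yields measurability of the count, as a limit
  inferior of measurable functions.\<close>

lemma num_discontinuities_eq_liminf:
  assumes g: "left_step g" and ab: "a \<le> b"
  shows "num_discontinuities g {a..b} = liminf (\<lambda>m. ennreal (card (grid_changes g a b m)))"
proof (rule antisym)
  let ?D = "discontinuities g {a..b}" and ?N = "\<lambda>m. ennreal (card (grid_changes g a b m))"
  have fin: "ennreal (card A) \<le> liminf ?N" if "finite A" "A \<subseteq> ?D" for A
    using card_le_grid_changes[OF g that] by (intro Liminf_bounded) (auto elim: eventually_mono)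
  show "num_discontinuities g {a..b} \<le> liminf ?N"
  proof (cases "finite ?D")
    case True
    then show ?thesis using fin[of ?D]
      by (simp add: num_discontinuities_def ennreal_of_nat_eq_real_of_nat)
  next
    case False
    have "of_nat r \<le> liminf ?N" for r
    proof -
      obtain A where "finite A" "card A = r" "A \<subseteq> ?D"
        using infinite_arbitrarily_large[OF False] by blast
      then show ?thesis using fin by (auto simp: ennreal_of_nat_eq_real_of_nat)
    qed
    then have "liminf ?N = \<top>"
      by (metis ennreal_SUP_of_nat_eq_top SUP_least top.extremum_uniqueI)
    then show ?thesis by simp
  qed
  show "liminf ?N \<le> num_discontinuities g {a..b}"
    using grid_changes_le[OF g ab] by (intro Liminf_le) (auto intro: always_eventually)
qed


subsection \<open>Dependence of the seeding on the exponent\<close>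

text \<open>These are the functions \<open>F\<^sub>i\<close>, the shared end points of neighbouring
  seeding intervals.\<close>

definition threshold ::
  "('a list \<Rightarrow> 'a list) \<Rightarrow> ('a \<Rightarrow> 'a \<Rightarrow> real) \<Rightarrow> 'a list \<Rightarrow> nat \<Rightarrow> real \<Rightarrow> real" where
  "threshold arr d C i \<alpha> = cum_weight arr d \<alpha> C i / cum_weight arr d \<alpha> C (length (arr C))"

lemma mem_seed_interval_iff:
  "z \<in> seed_interval arr d \<alpha> C i \<longleftrightarrow>
     threshold arr d C i \<alpha> \<le> z \<and> \<not> threshold arr d C (Suc i) \<alpha> \<le> z"
  unfolding seed_interval_def threshold_def by (auto simp: Let_def)

lemma threshold_0 [simp]: "threshold arr d C 0 \<alpha> = 0"
  by (simp add: threshold_def cum_weight_def)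

lemma threshold_mono_index: "i \<le> j \<Longrightarrow> threshold arr d C i \<alpha> \<le> threshold arr d C j \<alpha>"
  unfolding threshold_def cum_weight_def weight_def
  by (intro divide_right_mono sum_mono2 sum_nonneg) auto

lemma seed_interval_unique:
  assumes "z \<in> seed_interval arr d \<alpha> C i" "z \<in> seed_interval arr d \<alpha> C j"
  shows "i = j"
proof -
  have "\<not> i < j" if "z \<in> seed_interval arr d \<alpha> C i" "z \<in> seed_interval arr d \<alpha> C j" for i j
    using that threshold_mono_index[of "Suc i" j arr d C \<alpha>] by (auto simp: mem_seed_interval_iff)
  then show ?thesis using assms by (meson linorder_neqE_nat)
qed

text \<open>All tests in \<open>next_center\<close>, including the one for the fallback, are Boolean
  combinations of these comparisons. Later comparisons of two exponents within a round rest on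
  this.\<close>

lemma next_center_cong:
  assumes "\<And>i. i \<le> length (arr C) \<Longrightarrow> threshold arr d C i \<alpha> \<le> z \<longleftrightarrow> threshold arr d C i \<beta> \<le> z"
  shows "next_center arr d \<alpha> z C = next_center arr d \<beta> z C"
proof -
  have "i < length (arr C) \<and> z \<in> seed_interval arr d \<alpha> C i \<longleftrightarrow>
      i < length (arr C) \<and> z \<in> seed_interval arr d \<beta> C i" for i
    using assms[of i] assms[of "Suc i"] by (auto simp: mem_seed_interval_iff)
  then show ?thesis unfolding next_center_def by (simp only:)
qed

lemma measurable_next_center:
  "(\<lambda>z. next_center arr d \<alpha> z C) \<in> measurable borel (count_space UNIV)"
proof -
  have [measurable]: "(\<lambda>z. z \<in> seed_interval arr d \<alpha> C i) \<in> measurable borel (count_space UNIV)" for i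
    unfolding mem_seed_interval_iff by measurable
  have [measurable]: "(\<lambda>z. THE i. i < length (arr C) \<and> z \<in> seed_interval arr d \<alpha> C i)
      \<in> measurable borel (count_space UNIV)"
    by (rule measurable_THE[where I = UNIV]) (auto dest: seed_interval_unique)
  show ?thesis unfolding next_center_def by measurable
qed

locale seeding = clustering_instance V d k for V :: "'a set" and d k +
  fixes arr :: "'a list \<Rightarrow> 'a list"
  assumes arrangement: "is_arrangement V d arr"
begin

lemma set_arr: "set C \<subseteq> V \<Longrightarrow> set (arr C) = V"
  and length_arr: "set C \<subseteq> V \<Longrightarrow> length (arr C) = card V"
  using arrangement unfolding is_arrangement_def by (auto simp: distinct_card[symmetric])

lemma next_center_in:
  assumes "set C \<subseteq> V"
  shows "next_center arr d \<alpha> z C \<in> V"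
proof (cases "\<exists>i<length (arr C). z \<in> seed_interval arr d \<alpha> C i")
  case True
  then have "\<exists>!i. i < length (arr C) \<and> z \<in> seed_interval arr d \<alpha> C i"
    using seed_interval_unique by blast
  from theI'[OF this] show ?thesis
    using True set_arr[OF assms] unfolding next_center_def by (metis (no_types, lifting) nth_mem)
next
  case False
  have "arr C \<noteq> []" using length_arr[OF assms] k_pos k_le by auto
  then show ?thesis using False set_arr[OF assms] unfolding next_center_def by auto
qed

lemma set_seed: "set (seed arr d t \<alpha> Z) \<subseteq> V"
  by (induction t) (auto intro: next_center_in)

lemma dist_min_mem:
  assumes "C \<noteq> []"
  obtains c where "c \<in> set C" "dist_min d C v = d v c"
proof -
  have "dist_min d C v \<in> (\<lambda>c. d v c) ` set C"
    unfolding dist_min_def using assms by (intro Min_in) auto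
  then show thesis using that by auto
qed

lemma decreasing_dist_min:
  assumes "set C \<subseteq> V" "C \<noteq> []"
  shows "decreasing_nonneg (\<lambda>j. dist_min d C (arr C ! j)) (card V)"
proof
  fix j assume "j < card V"
  obtain c where "dist_min d C (arr C ! j) = d (arr C ! j) c"
    using dist_min_mem[OF assms(2)] by metis
  then show "0 \<le> dist_min d C (arr C ! j)" by simp
next
  fix i j assume "i \<le> j" "j < card V"
  moreover have "sorted_wrt (\<lambda>u v. dist_min d C u \<ge> dist_min d C v) (arr C)"
    using arrangement assms unfolding is_arrangement_def by auto
  ultimately show "dist_min d C (arr C ! j) \<le> dist_min d C (arr C ! i)"
    using length_arr[OF assms(1)] by (cases "i = j") (auto simp: sorted_wrt_iff_nth_less)
qed

lemma threshold_eq_ratio: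
  assumes "set C \<subseteq> V" "C \<noteq> []"
  shows "threshold arr d C i = (\<lambda>\<alpha>. decreasing_nonneg.W (\<lambda>j. dist_min d C (arr C ! j)) i \<alpha> /
           decreasing_nonneg.W (\<lambda>j. dist_min d C (arr C ! j)) (card V) \<alpha>)"
  using assms
  by (simp add: fun_eq_iff threshold_def cum_weight_def weight_def length_arr
      decreasing_nonneg.W_def[OF decreasing_dist_min])

text \<open>First-round weights are all \<open>1\<close>. The enumeration for the empty list need
  not be sorted, so this case is kept apart from decreasing sequences.\<close>

lemma threshold_Nil: "threshold arr d [] i \<alpha> = threshold arr d [] i \<beta>"
  by (simp add: threshold_def cum_weight_def weight_def)

lemma threshold_mono:
  assumes "set C \<subseteq> V" "i \<le> card V" "\<alpha> \<le> \<beta>"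
  shows "threshold arr d C i \<alpha> \<le> threshold arr d C i \<beta>"
proof (cases "C = []")
  case False
  then show ?thesis
    using decreasing_nonneg.ratio_mono[OF decreasing_dist_min] assms by (simp add: threshold_eq_ratio)
qed (metis threshold_Nil order_refl)

lemma isCont_threshold:
  assumes "set C \<subseteq> V" "i \<le> card V"
  shows "isCont (threshold arr d C i) \<alpha>"
proof (cases "C = []")
  case True
  have "threshold arr d [] i = (\<lambda>_. threshold arr d [] i 0)"
    using threshold_Nil by (intro ext)
  then show ?thesis using True by (metis continuous_const)
next
  case False
  then show ?thesis
    using decreasing_nonneg.isCont_ratio[OF decreasing_dist_min] assms by (simp add: threshold_eq_ratio)
qed

text \<open>The common value is \<open>1\<close>, or \<open>0\<close> once all points are centers.
  Hence only the \<open>card V - 1\<close> inner thresholds can move.\<close>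

lemma threshold_card_const:
  assumes "set C \<subseteq> V"
  shows "threshold arr d C (card V) \<alpha> = threshold arr d C (card V) \<beta>"
proof (cases "C = []")
  case False
  interpret decreasing_nonneg "\<lambda>j. dist_min d C (arr C ! j)" "card V"
    by (rule decreasing_dist_min[OF assms False])
  have "W (card V) \<alpha> / W (card V) \<alpha> = W (card V) \<beta> / W (card V) \<beta>"
    using W_pos_iff[of \<alpha>] W_pos_iff[of \<beta>] ratio_eq_0
    by (metis divide_self less_irrefl)
  then show ?thesis by (simp add: threshold_eq_ratio[OF assms False])
qed (metis threshold_Nil)

lemma threshold_diff_le_ln:
  assumes "set C \<subseteq> V" "i \<le> card V" "0 < \<alpha>" "\<alpha> \<le> \<beta>"
  shows "threshold arr d C i \<beta> - threshold arr d C i \<alpha> \<le> ln (card V) * ln \<beta> - ln (card V) * ln \<alpha>"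
proof (cases "C = []")
  case True
  have "ln (card V) * ln \<alpha> \<le> ln (card V) * ln \<beta>"
    using assms k_pos k_le by (intro mult_left_mono) auto
  then show ?thesis using True threshold_Nil[of i \<alpha> \<beta>] by simp
next
  case False
  then show ?thesis
    using decreasing_nonneg.ratio_diff_le_ln[OF decreasing_dist_min] assms
    by (simp add: threshold_eq_ratio)
qed

section \<open>Ratios of distances and the linear bound\<close>

lemma finite_dist_ratios:
  "finite {d x y / d u v | x y u v.
     x \<in> V \<and> y \<in> V \<and> u \<in> V \<and> v \<in> V \<and> d x y \<noteq> 0 \<and> d u v \<noteq> 0}"
proof (rule finite_subset)
  show "finite ((\<lambda>(x, y, u, v). d x y / d u v) ` (V \<times> V \<times> V \<times> V))"
    using finite_points by simp
qed force

lemma dist_ratio_le: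
  assumes "x \<in> V" "y \<in> V" "u \<in> V" "v \<in> V" "d x y \<noteq> 0" "d u v \<noteq> 0"
  shows "d x y / d u v \<le> max_dist_ratio V d"
  unfolding max_dist_ratio_def
  by (intro Max_ge[OF finite_dist_ratios] CollectI exI conjI, rule refl) (use assms in simp_all)

text \<open>Two distinct points give the ratio \<open>1\<close>. For a single point the set of
  ratios is empty and \<open>Max\<close> is unspecified.\<close>

lemma max_dist_ratio_ge_1:
  assumes "2 \<le> card V"
  shows "1 \<le> max_dist_ratio V d"
proof -
  obtain x y where "x \<in> V" "y \<in> V" "x \<noteq> y"
    using assms by (metis card_2_iff' obtain_subset_with_card_n subsetD)
  then have "d x y / d x y = 1" "d x y / d x y \<le> max_dist_ratio V d"
    by (simp, intro dist_ratio_le) auto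
  then show ?thesis by simp
qed

lemma threshold_diff_le_linear:
  assumes "set C \<subseteq> V" "i \<le> card V" "\<alpha> \<le> \<beta>" "2 \<le> card V"
  defines "L \<equiv> ln (max_dist_ratio V d)"
  shows "threshold arr d C i \<beta> - threshold arr d C i \<alpha> \<le> L * \<beta> - L * \<alpha>"
proof (cases "C = []")
  case True
  have "L * \<alpha> \<le> L * \<beta>"
    using assms max_dist_ratio_ge_1 by (intro mult_left_mono) auto
  then show ?thesis using True threshold_Nil[of i \<alpha> \<beta>] by simp
next
  case False
  \<comment> \<open>Both minima are attained at centers, so their quotient is a ratio of distances
    in \<open>V\<close>.\<close>
  have "dist_min d C (arr C ! j) / dist_min d C (arr C ! l) \<le> max_dist_ratio V d"
    if "j < card V" "l < card V" "dist_min d C (arr C ! j) \<noteq> 0" "dist_min d C (arr C ! l) \<noteq> 0"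
    for j l
  proof -
    obtain c where c: "c \<in> set C" "dist_min d C (arr C ! j) = d (arr C ! j) c"
      using dist_min_mem[OF False] .
    obtain c' where c': "c' \<in> set C" "dist_min d C (arr C ! l) = d (arr C ! l) c'"
      using dist_min_mem[OF False] .
    have "arr C ! j \<in> V" "arr C ! l \<in> V"
      using that assms(1) by (metis length_arr nth_mem set_arr)+
    then show ?thesis using c c' that assms(1) by (auto intro!: dist_ratio_le)
  qed
  then show ?thesis
    using decreasing_nonneg.ratio_diff_le_linear[OF decreasing_dist_min[OF assms(1) False] assms(2,3)
        max_dist_ratio_ge_1[OF assms(4)]] assms False
    by (simp add: threshold_eq_ratio)
qed

section \<open>One-sided limits of the output in the exponent\<close>

text \<open>Just below \<open>\<alpha>\<close>, a comparison that holds persists by monotonicity;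
  one that fails is a strict inequality and persists by continuity.\<close>

lemma eventually_next_center_left:
  assumes C: "set C \<subseteq> V"
  shows "\<forall>\<^sub>F y in at_left \<alpha>. next_center arr d y z C = next_center arr d \<alpha> z C"
proof -
  have "\<forall>\<^sub>F y in at_left \<alpha>. threshold arr d C i y \<le> z \<longleftrightarrow> threshold arr d C i \<alpha> \<le> z"
    if i: "i \<le> card V" for i
  proof (cases "threshold arr d C i \<alpha> \<le> z")
    case True
    have "\<forall>\<^sub>F y in at_left \<alpha>. y < \<alpha>" by (simp add: eventually_at_filter)
    then show ?thesis
    proof eventually_elim
      case (elim y)
      then show ?case using True threshold_mono[OF C i, of y \<alpha>] by auto
    qed
  next
    case False
    have "(threshold arr d C i \<longlongrightarrow> threshold arr d C i \<alpha>) (at_left \<alpha>)"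
      using isCont_threshold[OF C i, of \<alpha>] unfolding continuous_at
      by (rule tendsto_mono[rotated]) (simp add: at_le)
    then have "\<forall>\<^sub>F y in at_left \<alpha>. z < threshold arr d C i y"
      using False by (intro order_tendstoD(1)) auto
    then show ?thesis by eventually_elim (use False in auto)
  qed
  then have "\<forall>\<^sub>F y in at_left \<alpha>. \<forall>i\<in>{..card V}. threshold arr d C i y \<le> z \<longleftrightarrow> threshold arr d C i \<alpha> \<le> z"
    by (intro eventually_ball_finite) auto
  then show ?thesis
    by eventually_elim (auto intro!: next_center_cong simp: length_arr[OF C])
qed

text \<open>By monotonicity, the exponents above \<open>\<alpha>\<close> at which a given comparison
  holds form an initial segment, so its outcome is constant just to the right of
  \<open>\<alpha>\<close>. Finitely many comparisons share such an interval.\<close>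

lemma eventually_next_center_right:
  assumes C: "set C \<subseteq> V"
  shows "\<exists>c. \<forall>\<^sub>F y in at_right \<alpha>. next_center arr d y z C = c"
proof -
  have "\<exists>x>\<alpha>. \<forall>y. \<alpha> < y \<longrightarrow> y \<le> x \<longrightarrow> (threshold arr d C i y \<le> z \<longleftrightarrow> threshold arr d C i x \<le> z)"
    if i: "i \<le> card V" for i
  proof (cases "\<exists>x>\<alpha>. threshold arr d C i x \<le> z")
    case True
    then show ?thesis using threshold_mono[OF C i] by (meson order_trans)
  next
    case False
    then show ?thesis by (intro exI[of _ "\<alpha> + 1"]) auto
  qed
  then obtain x where x: "\<And>i. i \<le> card V \<Longrightarrow> \<alpha> < x i"
    "\<And>i y. i \<le> card V \<Longrightarrow> \<alpha> < y \<Longrightarrow> y \<le> x i \<Longrightarrow>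
       (threshold arr d C i y \<le> z \<longleftrightarrow> threshold arr d C i (x i) \<le> z)"
    by metis
  define x0 where "x0 = Min (x ` {..card V})"
  have x0: "\<alpha> < x0" "\<And>i. i \<le> card V \<Longrightarrow> x0 \<le> x i"
    unfolding x0_def using x(1) by auto
  have "next_center arr d y z C = next_center arr d x0 z C" if y: "\<alpha> < y" "y < x0" for y
  proof (rule next_center_cong)
    fix i assume "i \<le> length (arr C)"
    then have i: "i \<le> card V" by (simp add: length_arr[OF C])
    show "threshold arr d C i y \<le> z \<longleftrightarrow> threshold arr d C i x0 \<le> z"
      using x(2)[OF i, of y] x(2)[OF i, of x0] x0(1) x0(2)[OF i] y by auto
  qed
  then show ?thesis
    unfolding eventually_at_right_field using x0(1) by blast
qed

lemma left_step_seed: "left_step (\<lambda>\<alpha>. seed arr d t \<alpha> Z)"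
proof (induction t)
  case 0
  then show ?case by (auto simp: left_step_def)
next
  case (Suc t)
  show ?case unfolding left_step_def
  proof (intro allI conjI)
    fix \<alpha>
    have "\<forall>\<^sub>F y in at_left \<alpha>. seed arr d t y Z = seed arr d t \<alpha> Z"
      using Suc unfolding left_step_def by blast
    then show "\<forall>\<^sub>F y in at_left \<alpha>. seed arr d (Suc t) y Z = seed arr d (Suc t) \<alpha> Z"
      using eventually_next_center_left[OF set_seed[of t \<alpha> Z], where \<alpha> = \<alpha> and z = "Z t"]
      by eventually_elim simp
    obtain C where C: "\<forall>\<^sub>F y in at_right \<alpha>. seed arr d t y Z = C"
      using Suc unfolding left_step_def by blast
    \<comment> \<open>The filter is nontrivial, so \<open>C\<close> is an actual output and
      therefore consists of points of \<open>V\<close>.\<close>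
    then obtain y where "seed arr d t y Z = C"
      by (meson eventually_happens' trivial_limit_at_right_real)
    then have "set C \<subseteq> V" using set_seed by blast
    then obtain c where "\<forall>\<^sub>F y in at_right \<alpha>. next_center arr d y (Z t) C = c"
      using eventually_next_center_right by blast
    with C have "\<forall>\<^sub>F y in at_right \<alpha>. seed arr d (Suc t) y Z = C @ [c]"
      by eventually_elim simp
    then show "\<exists>c. \<forall>\<^sub>F y in at_right \<alpha>. seed arr d (Suc t) y Z = c" by blast
  qed
qed

end


subsection \<open>Expected number of discontinuities\<close>

abbreviation U01 :: "real measure" where "U01 \<equiv> uniform_measure lborel {0..1}"

lemma prob_space_U01: "prob_space U01"
  by (intro prob_space_uniform_measure) auto

lemma emeasure_U01_le:
  assumes "a \<le> b"
  shows "emeasure U01 {a..<b} \<le> ennreal (b - a)"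
proof -
  have "emeasure U01 {a..<b} = emeasure lborel ({0..1} \<inter> {a..<b})"
    by (simp add: emeasure_uniform_measure divide_ennreal_def)
  also have "\<dots> \<le> emeasure lborel {a..<b}"
    by (intro emeasure_mono) auto
  finally show ?thesis using assms by simp
qed

lemma sets_neq:
  assumes "f \<in> measurable M (count_space A)" "g \<in> measurable M (count_space A)" "finite A"
  shows "{x \<in> space M. f x \<noteq> g x} \<in> sets M"
proof -
  have "{x \<in> space M. f x \<noteq> g x} = (\<Union>a\<in>A. (f -` {a} \<inter> space M) - (g -` {a} \<inter> space M))"
    using measurable_space[OF assms(1)] by auto
  also have "\<dots> \<in> sets M"
    using assms by (intro sets.finite_UN sets.Diff) (auto intro!: measurable_sets)
  finally show ?thesis .
qed

context seeding
begin

text \<open>Only finitely many center lists are possible, so each list of earlier centers is treated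
  separately. The dimension \<open>m\<close> stays fixed while \<open>t\<close> grows in the
  induction.\<close>

lemma measurable_seed:
  assumes "t \<le> m"
  shows "seed arr d t \<alpha> \<in> measurable (uniform_cube m) (count_space {C. set C \<subseteq> V \<and> length C = t})"
  using assms
proof (induction t)
  case 0
  have "seed arr d 0 \<alpha> = (\<lambda>_. [])" by (simp add: fun_eq_iff)
  then show ?case by simp
next
  case (Suc t)
  let ?L = "\<lambda>t. {C. set C \<subseteq> V \<and> length C = t}"
  have comp: "(\<lambda>Z. Z t) \<in> measurable (uniform_cube m) borel"
  proof -
    have "(\<lambda>Z. Z t) \<in> measurable (uniform_cube m) U01"
      unfolding uniform_cube_def using Suc.prems by (intro measurable_component_singleton) simp
    moreover have "measurable (uniform_cube m) U01 = measurable (uniform_cube m) borel"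
      by (intro measurable_cong_sets) auto
    ultimately show ?thesis by simp
  qed
  have "(\<lambda>Z. seed arr d t \<alpha> Z @ [next_center arr d \<alpha> (Z t) (seed arr d t \<alpha> Z)])
      \<in> measurable (uniform_cube m) (count_space (?L (Suc t)))"
  proof (rule measurable_compose_countable'[where I = "?L t" and g = "seed arr d t \<alpha>"
        and f = "\<lambda>C Z. C @ [next_center arr d \<alpha> (Z t) C]"])
    fix C assume C: "C \<in> ?L t"
    have "(\<lambda>Z. next_center arr d \<alpha> (Z t) C) \<in> measurable (uniform_cube m) (count_space UNIV)"
      using comp measurable_next_center by (rule measurable_compose)
    then have "(\<lambda>Z. C @ [next_center arr d \<alpha> (Z t) C])
        \<in> measurable (uniform_cube m) (count_space UNIV)"
      by (rule measurable_compose) simp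
    then show "(\<lambda>Z. C @ [next_center arr d \<alpha> (Z t) C])
        \<in> measurable (uniform_cube m) (count_space (?L (Suc t)))"
      by (rule measurable_count_space_extend[rotated 2]) (use C next_center_in in auto)
  next
    show "seed arr d t \<alpha> \<in> measurable (uniform_cube m) (count_space (?L t))"
      using Suc by simp
    show "countable (?L t)"
      by (intro countable_finite finite_lists_length_eq finite_points)
  qed
  then show ?case by (simp cong: measurable_cong)
qed

lemma sets_seed_neq:
  assumes "t \<le> m"
  shows "{Z \<in> space (uniform_cube m). seed arr d t \<alpha> Z \<noteq> seed arr d t \<beta> Z} \<in> sets (uniform_cube m)"
  by (rule sets_neq[OF measurable_seed[OF assms] measurable_seed[OF assms]])
     (intro finite_lists_length_eq finite_points)

lemma seed_cong: "(\<And>s. s < t \<Longrightarrow> Z s = Z' s) \<Longrightarrow> seed arr d t \<alpha> Z = seed arr d t \<alpha> Z'"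
  by (induction t) auto

section \<open>Probability that two exponents give different outputs\<close>

text \<open>The two choices differ only if \<open>z\<close> lies between the two values of some
  threshold. The union bound runs over the inner indices, the outer thresholds being
  constant.\<close>

lemma prob_next_center_neq:
  assumes C: "set C \<subseteq> V" and ab: "\<alpha> \<le> \<beta>"
    and \<Delta>: "\<And>i. i \<le> card V \<Longrightarrow> threshold arr d C i \<beta> - threshold arr d C i \<alpha> \<le> \<Delta>"
  shows "emeasure U01 {z. next_center arr d \<alpha> z C \<noteq> next_center arr d \<beta> z C}
           \<le> ennreal (real (card V - 1) * \<Delta>)"
proof -
  let ?F = "threshold arr d C"
  \<comment> \<open>The threshold of index \<open>0\<close> is constantly \<open>0\<close>, so any
    bound on the increments is nonnegative.\<close>
  have "0 \<le> \<Delta>" using \<Delta>[of 0] by simp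
  have const: "?F (card V) \<alpha> = ?F (card V) \<beta>"
    by (rule threshold_card_const[OF C])
  have "{z. next_center arr d \<alpha> z C \<noteq> next_center arr d \<beta> z C} \<subseteq>
      (\<Union>i\<in>{1..<card V}. {?F i \<alpha>..<?F i \<beta>})"
  proof (rule subsetI, rule ccontr)
    fix z assume z: "z \<in> {z. next_center arr d \<alpha> z C \<noteq> next_center arr d \<beta> z C}"
      and no: "z \<notin> (\<Union>i\<in>{1..<card V}. {?F i \<alpha>..<?F i \<beta>})"
    have "next_center arr d \<alpha> z C = next_center arr d \<beta> z C"
    proof (rule next_center_cong)
      fix i assume "i \<le> length (arr C)"
      then have i: "i \<le> card V" by (simp add: length_arr[OF C])
      consider "i = 0" | "i = card V" | "i \<in> {1..<card V}" using i by force
      then show "?F i \<alpha> \<le> z \<longleftrightarrow> ?F i \<beta> \<le> z"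
      proof cases
        case 3
        then have "z \<notin> {?F i \<alpha>..<?F i \<beta>}" using no by blast
        then show ?thesis using threshold_mono[OF C i ab] by auto
      qed (simp_all add: const)
    qed
    then show False using z by simp
  qed
  then have "emeasure U01 {z. next_center arr d \<alpha> z C \<noteq> next_center arr d \<beta> z C} \<le>
      emeasure U01 (\<Union>i\<in>{1..<card V}. {?F i \<alpha>..<?F i \<beta>})"
    by (intro emeasure_mono) auto
  also have "\<dots> \<le> (\<Sum>i\<in>{1..<card V}. emeasure U01 {?F i \<alpha>..<?F i \<beta>})"
    by (intro emeasure_subadditive_finite) auto
  also have "\<dots> \<le> (\<Sum>i\<in>{1..<card V}. ennreal \<Delta>)"
  proof (intro sum_mono)
    fix i assume "i \<in> {1..<card V}"
    then have i: "i \<le> card V" by simp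
    show "emeasure U01 {?F i \<alpha>..<?F i \<beta>} \<le> ennreal \<Delta>"
      using emeasure_U01_le[OF threshold_mono[OF C i ab]] \<Delta>[OF i]
      by (meson ennreal_leI order_trans)
  qed
  also have "\<dots> = ennreal (real (card V - 1) * \<Delta>)"
    using \<open>0 \<le> \<Delta>\<close> by (simp add: ennreal_mult' ennreal_of_nat_eq_real_of_nat)
  finally show ?thesis .
qed

text \<open>By induction, integrating over the last coordinate with the others fixed: either the
  earlier centers differ already, or they agree and the new draw separates the choices with
  probability at most \<open>?p\<close>. As \<open>\<Delta>\<close> is uniform in \<open>C\<close>,
  the rounds add up.\<close>

lemma prob_seed_neq:
  assumes ab: "\<alpha> \<le> \<beta>"
    and \<Delta>: "\<And>C i. set C \<subseteq> V \<Longrightarrow> i \<le> card V \<Longrightarrow>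
                threshold arr d C i \<beta> - threshold arr d C i \<alpha> \<le> \<Delta>"
  shows "emeasure (uniform_cube t)
           {Z \<in> space (uniform_cube t). seed arr d t \<alpha> Z \<noteq> seed arr d t \<beta> Z}
           \<le> ennreal (real t * (real (card V - 1) * \<Delta>))"
proof (induction t)
  case 0
  then show ?case by simp
next
  case (Suc t)
  interpret P: product_sigma_finite "\<lambda>_::nat. U01"
    using prob_space_U01 by (intro product_sigma_finite.intro prob_space_imp_sigma_finite)
  interpret cube: prob_space "uniform_cube t"
    unfolding uniform_cube_def by (intro prob_space_PiM prob_space_U01)
  let ?p = "real (card V - 1) * \<Delta>"
  have p: "0 \<le> ?p" using \<Delta>[of "[]" 0] by simp
  let ?A = "\<lambda>t. {Z \<in> space (uniform_cube t). seed arr d t \<alpha> Z \<noteq> seed arr d t \<beta> Z}"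
  have A: "?A t \<in> sets (uniform_cube t)" for t
    by (rule sets_seed_neq) simp
  have cube_Suc: "uniform_cube (Suc t) = (\<Pi>\<^sub>M s\<in>insert t {..<t}. U01)"
    by (simp add: uniform_cube_def lessThan_Suc)
  have "emeasure (uniform_cube (Suc t)) (?A (Suc t)) =
      (\<integral>\<^sup>+ Z. indicator (?A (Suc t)) Z \<partial>uniform_cube (Suc t))"
    by (rule nn_integral_indicator[OF A, symmetric])
  also have "\<dots> = (\<integral>\<^sup>+ Z. (\<integral>\<^sup>+ z. indicator (?A (Suc t)) (Z(t := z)) \<partial>U01) \<partial>uniform_cube t)"
    unfolding cube_Suc unfolding uniform_cube_def[of t]
    by (rule P.product_nn_integral_insert)
       (use A[of "Suc t"] cube_Suc in \<open>auto intro!: borel_measurable_indicator\<close>)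
  also have "\<dots> \<le> (\<integral>\<^sup>+ Z. indicator (?A t) Z + ennreal ?p \<partial>uniform_cube t)"
  proof (intro nn_integral_mono)
    fix Z assume Z: "Z \<in> space (uniform_cube t)"
    have upd: "seed arr d t \<gamma> (Z(t := z)) = seed arr d t \<gamma> Z" for z \<gamma>
      by (rule seed_cong) simp
    show "(\<integral>\<^sup>+ z. indicator (?A (Suc t)) (Z(t := z)) \<partial>U01) \<le> indicator (?A t) Z + ennreal ?p"
    proof (cases "seed arr d t \<alpha> Z = seed arr d t \<beta> Z")
      case False
      have "(\<integral>\<^sup>+ z. indicator (?A (Suc t)) (Z(t := z)) \<partial>U01) \<le> (\<integral>\<^sup>+ z. 1 \<partial>U01)"
        by (intro nn_integral_mono) (auto simp: indicator_def)
      also have "\<dots> = 1" using prob_space.emeasure_space_1[OF prob_space_U01] by simp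
      also have "1 \<le> indicator (?A t) Z + ennreal ?p" using False Z by simp
      finally show ?thesis .
    next
      case True
      define C where "C = seed arr d t \<alpha> Z"
      have C: "set C \<subseteq> V" unfolding C_def by (rule set_seed)
      let ?N = "{z. next_center arr d \<alpha> z C \<noteq> next_center arr d \<beta> z C}"
      have "(\<lambda>z. next_center arr d \<gamma> z C) \<in> measurable borel (count_space V)" for \<gamma>
        by (rule measurable_count_space_extend[OF subset_UNIV _ measurable_next_center])
           (use next_center_in[OF C] in auto)
      from sets_neq[OF this this finite_points] have N: "?N \<in> sets U01" by simp
      have "(\<integral>\<^sup>+ z. indicator (?A (Suc t)) (Z(t := z)) \<partial>U01) \<le> (\<integral>\<^sup>+ z. indicator ?N z \<partial>U01)"
        using True by (intro nn_integral_mono) (auto simp: indicator_def upd C_def)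
      also have "\<dots> = emeasure U01 ?N" using N by (rule nn_integral_indicator)
      also have "\<dots> \<le> ennreal ?p" using C ab \<Delta> by (intro prob_next_center_neq) auto
      finally show ?thesis using True by simp
    qed
  qed
  also have "\<dots> = emeasure (uniform_cube t) (?A t) + ennreal ?p"
    using A[of t] cube.emeasure_space_1 by (simp add: nn_integral_add)
  also have "\<dots> \<le> ennreal (real t * ?p) + ennreal ?p"
    using Suc by (intro add_right_mono)
  also have "\<dots> = ennreal (real (Suc t) * ?p)"
    using p by (subst ennreal_plus[symmetric]) (auto simp: distrib_right add.commute)
  finally show ?case .
qed

section \<open>From grids to the expectation\<close>

text \<open>\<open>\<phi>\<close> is a potential whose increments dominate those of all thresholds
  at once; over a grid they telescope to \<open>\<phi> b - \<phi> a\<close>, whatever the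
  mesh.\<close>

lemma expected_discontinuities_le:
  assumes ab: "a \<le> b"
    and \<phi>: "\<And>C i \<alpha> \<beta>. set C \<subseteq> V \<Longrightarrow> i \<le> card V \<Longrightarrow> a \<le> \<alpha> \<Longrightarrow> \<alpha> \<le> \<beta> \<Longrightarrow>
             threshold arr d C i \<beta> - threshold arr d C i \<alpha> \<le> \<phi> \<beta> - \<phi> \<alpha>"
    and B: "real k * (real (card V - 1) * (\<phi> b - \<phi> a)) \<le> B"
  shows "expected_at_most (uniform_cube k)
           (\<lambda>Z. num_discontinuities (\<lambda>\<alpha>. seed arr d k \<alpha> Z) {a..b}) B"
proof -
  define c where "c = real k * real (card V - 1)"
  define x where "x m i = grid a b m i" for m i
  define E where "E m i = {Z \<in> space (uniform_cube k). seed arr d k (x m i) Z \<noteq> seed arr d k (x m (Suc i)) Z}"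
    for m i
  define N where "N m Z = (\<Sum>i<m. indicator (E m i) Z :: ennreal)" for m Z
  have E [measurable]: "E m i \<in> sets (uniform_cube k)" for m i
    unfolding E_def by (rule sets_seed_neq) simp
  have N [measurable]: "N m \<in> borel_measurable (uniform_cube k)" for m
    unfolding N_def[abs_def] by measurable
  have "num_discontinuities (\<lambda>\<alpha>. seed arr d k \<alpha> Z) {a..b} = liminf (\<lambda>m. N m Z)"
    if Z: "Z \<in> space (uniform_cube k)" for Z
  proof -
    have "ennreal (card (grid_changes (\<lambda>\<alpha>. seed arr d k \<alpha> Z) a b m)) = N m Z" for m
    proof -
      have "N m Z = (\<Sum>i<m. if i \<in> grid_changes (\<lambda>\<alpha>. seed arr d k \<alpha> Z) a b m then 1 else 0)"
        unfolding N_def E_def x_def using Z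
        by (intro sum.cong) (auto simp: grid_changes_def indicator_def)
      also have "\<dots> = of_nat (card (grid_changes (\<lambda>\<alpha>. seed arr d k \<alpha> Z) a b m))"
      proof -
        have "{..<m} \<inter> grid_changes (\<lambda>\<alpha>. seed arr d k \<alpha> Z) a b m =
            grid_changes (\<lambda>\<alpha>. seed arr d k \<alpha> Z) a b m"
          by (auto simp: grid_changes_def)
        then show ?thesis by (simp add: sum.inter_restrict[symmetric])
      qed
      finally show ?thesis by (simp add: ennreal_of_nat_eq_real_of_nat)
    qed
    then show ?thesis
      using num_discontinuities_eq_liminf[OF left_step_seed ab, of k Z] by simp
  qed
  note eq = this
  have meas: "(\<lambda>Z. num_discontinuities (\<lambda>\<alpha>. seed arr d k \<alpha> Z) {a..b})
      \<in> borel_measurable (uniform_cube k)"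
    by (subst measurable_cong[OF eq]) auto
  have int_N: "(\<integral>\<^sup>+ Z. N m Z \<partial>uniform_cube k) \<le> ennreal B" for m
  proof -
    have x_mono: "x m i \<le> x m (Suc i)" "a \<le> x m i" for i
      unfolding x_def using grid_mono[OF ab, of i "Suc i" m] grid_mono[OF ab, of 0 i m]
      by (auto simp: grid_0)
    have \<phi>_mono: "\<phi> \<alpha> \<le> \<phi> \<beta>" if "a \<le> \<alpha>" "\<alpha> \<le> \<beta>" for \<alpha> \<beta>
      using \<phi>[of "[]" 0 \<alpha> \<beta>] that by simp
    have "0 \<le> c * (\<phi> b - \<phi> a)"
      unfolding c_def using \<phi>_mono[of a b] ab by simp
    have "(\<integral>\<^sup>+ Z. N m Z \<partial>uniform_cube k) = (\<Sum>i<m. emeasure (uniform_cube k) (E m i))"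
      unfolding N_def by (subst nn_integral_sum) auto
    also have "\<dots> \<le> (\<Sum>i<m. ennreal (c * (\<phi> (x m (Suc i)) - \<phi> (x m i))))"
    proof (intro sum_mono)
      fix i
      show "emeasure (uniform_cube k) (E m i) \<le> ennreal (c * (\<phi> (x m (Suc i)) - \<phi> (x m i)))"
        unfolding E_def c_def mult.assoc using x_mono \<phi> by (intro prob_seed_neq) auto
    qed
    also have "\<dots> = ennreal (\<Sum>i<m. c * (\<phi> (x m (Suc i)) - \<phi> (x m i)))"
      using x_mono \<phi>_mono by (intro sum_ennreal) (simp add: c_def)
    also have "(\<Sum>i<m. c * (\<phi> (x m (Suc i)) - \<phi> (x m i))) = c * (\<phi> (x m m) - \<phi> (x m 0))"
      using sum_lessThan_telescope[of "\<lambda>i. \<phi> (x m i)" m] by (simp add: sum_distrib_left[symmetric])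
    also have "\<dots> \<le> B"
    \<comment> \<open>For \<open>m = 0\<close> division by zero puts all grid points at
      \<open>a\<close>; what remains is \<open>0 \<le> B\<close>.\<close>
    proof (cases "m = 0")
      case True
      then show ?thesis using B \<open>0 \<le> c * (\<phi> b - \<phi> a)\<close> by (simp add: c_def mult.assoc)
    next
      case False
      then show ?thesis using B by (simp add: x_def grid_0 grid_end c_def mult.assoc)
    qed
    finally show ?thesis by (simp add: ennreal_leI)
  qed
  have "(\<integral>\<^sup>+ Z. num_discontinuities (\<lambda>\<alpha>. seed arr d k \<alpha> Z) {a..b} \<partial>uniform_cube k) =
      (\<integral>\<^sup>+ Z. liminf (\<lambda>m. N m Z) \<partial>uniform_cube k)"
    by (intro nn_integral_cong eq)
  also have "\<dots> \<le> liminf (\<lambda>m. \<integral>\<^sup>+ Z. N m Z \<partial>uniform_cube k)"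
    by (intro nn_integral_liminf N)
  also have "\<dots> \<le> ennreal B"
    using int_N by (intro Liminf_le) (auto intro: always_eventually)
  finally show ?thesis unfolding expected_at_most_def using meas by simp
qed

section \<open>The two explicit bounds\<close>

lemma expected_discontinuities_log:
  assumes "0 < a" "a \<le> b"
  shows "expected_at_most (uniform_cube k)
           (\<lambda>Z. num_discontinuities (\<lambda>\<alpha>. seed arr d k \<alpha> Z) {a..b})
           (real (card V) * real k * ln (real (card V)) * ln (b / a))"
proof (rule expected_discontinuities_le[OF assms(2), where \<phi> = "\<lambda>\<alpha>. ln (card V) * ln \<alpha>"])
  have n: "1 \<le> card V" using k_pos k_le by simp
  have "0 \<le> real k * (ln (card V) * ln (b / a))" using n assms by simp
  then have "real (card V - 1) * (real k * (ln (card V) * ln (b / a)))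
      \<le> real (card V) * (real k * (ln (card V) * ln (b / a)))"
    by (rule mult_right_mono[rotated]) simp
  then show "real k * (real (card V - 1) * (ln (card V) * ln b - ln (card V) * ln a))
      \<le> real (card V) * real k * ln (real (card V)) * ln (b / a)"
    using assms unfolding right_diff_distrib[symmetric] by (simp add: ln_div mult_ac)
qed (use assms in \<open>auto intro!: threshold_diff_le_ln\<close>)

text \<open>The linear part of the potential adds at most \<open>1\<close>. For
  \<open>n \<ge> 2\<close> this is absorbed by \<open>1 / (\<delta> * ln 2)\<close> times
  \<open>ln n * M\<close>, as \<open>ln n \<ge> ln 2\<close> and \<open>M \<ge> \<delta>\<close>;
  hence the constant.\<close>

lemma expected_discontinuities_from_0:
  assumes \<delta>: "0 < \<delta>" and b: "0 \<le> b"
  shows "expected_at_most (uniform_cube k)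
           (\<lambda>Z. num_discontinuities (\<lambda>\<alpha>. seed arr d k \<alpha> Z) {0..b})
           ((1 + 1 / (\<delta> * ln 2)) * (real (card V) * real k * ln (real (card V)) *
             max \<delta> (ln (b * ln (max_dist_ratio V d)))))"
proof (cases "2 \<le> card V")
  case False
  \<comment> \<open>With one point no threshold moves, and \<open>ln 1 = 0\<close> makes the bound
    \<open>0\<close> whatever value \<open>max_dist_ratio\<close> has.\<close>
  have n: "card V = 1" using False k_pos k_le by simp
  show ?thesis
  proof (rule expected_discontinuities_le[OF b, where \<phi> = "\<lambda>_. 0"])
    fix C i and \<alpha> \<beta> :: real assume "set C \<subseteq> V" "i \<le> card V"
    then show "threshold arr d C i \<beta> - threshold arr d C i \<alpha> \<le> 0 - 0"
      using threshold_card_const[of C \<beta> \<alpha>] n by (cases "i = 0") (auto simp: le_Suc_eq)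
  qed (simp add: n)
next
  case True
  define n where "n = real (card V)"
  define L where "L = ln (max_dist_ratio V d)"
  define M where "M = max \<delta> (ln (b * L))"
  have n: "2 \<le> n" "real (card V - 1) \<le> n" using True by (auto simp: n_def)
  have L: "0 \<le> L" using max_dist_ratio_ge_1[OF True] by (simp add: L_def)
  have linear: "threshold arr d C i \<beta> - threshold arr d C i \<alpha> \<le> L * \<beta> - L * \<alpha>"
    if "set C \<subseteq> V" "i \<le> card V" "\<alpha> \<le> \<beta>" for C i \<alpha> \<beta>
    using threshold_diff_le_linear[OF that True] by (simp add: L_def)
  have ln2: "0 < ln (2::real)" "ln 2 \<le> ln n" using n by auto
  have M: "\<delta> \<le> M" "ln (b * L) \<le> M" by (auto simp: M_def)
  have "1 \<le> 1 / (\<delta> * ln 2) * (ln n * M)"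
  proof -
    have "\<delta> * ln 2 \<le> ln n * M"
      using mult_mono[OF M(1) ln2(2)] \<delta> ln2 M by (simp add: mult.commute)
    then show ?thesis using \<delta> ln2 by (simp add: field_simps)
  qed
  moreover have "0 \<le> ln n * M" "ln n * ln (b * L) \<le> ln n * M"
    using ln2 M \<delta> n by (auto intro!: mult_nonneg_nonneg mult_left_mono)
  \<comment> \<open>The left-hand sides bound the total increment of the potential for
    \<open>b * L \<le> 1\<close> and for \<open>b * L > 1\<close> respectively.\<close>
  ultimately have one: "1 \<le> (1 + 1 / (\<delta> * ln 2)) * (ln n * M)"
      "1 + ln n * ln (b * L) \<le> (1 + 1 / (\<delta> * ln 2)) * (ln n * M)"
    by (auto simp: distrib_right)
  have reduce: ?thesis
    if y: "0 \<le> \<phi> b - \<phi> 0" "\<phi> b - \<phi> 0 \<le> (1 + 1 / (\<delta> * ln 2)) * (ln n * M)"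
      and \<phi>: "\<And>C i \<alpha> \<beta>. set C \<subseteq> V \<Longrightarrow> i \<le> card V \<Longrightarrow> 0 \<le> \<alpha> \<Longrightarrow> \<alpha> \<le> \<beta> \<Longrightarrow>
             threshold arr d C i \<beta> - threshold arr d C i \<alpha> \<le> \<phi> \<beta> - \<phi> \<alpha>" for \<phi>
  proof (rule expected_discontinuities_le[OF b \<phi>])
    have "real (card V - 1) * (\<phi> b - \<phi> 0) \<le> n * ((1 + 1 / (\<delta> * ln 2)) * (ln n * M))"
      using y n by (intro mult_mono) auto
    then have "real k * (real (card V - 1) * (\<phi> b - \<phi> 0))
        \<le> real k * (n * ((1 + 1 / (\<delta> * ln 2)) * (ln n * M)))"
      by (intro mult_left_mono) auto
    then show "real k * (real (card V - 1) * (\<phi> b - \<phi> 0)) \<le> (1 + 1 / (\<delta> * ln 2)) *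
        (real (card V) * real k * ln (real (card V)) * max \<delta> (ln (b * ln (max_dist_ratio V d))))"
      unfolding n_def[symmetric] L_def[symmetric] M_def[symmetric] by (simp only: mult_ac)
  qed
  show ?thesis
  proof (cases "b * L \<le> 1")
    case True
    show ?thesis
    proof (rule reduce[of "\<lambda>\<alpha>. L * \<alpha>"])
      show "L * b - L * 0 \<le> (1 + 1 / (\<delta> * ln 2)) * (ln n * M)"
        using True one(1) by (simp add: mult.commute)
    qed (use L b linear in auto)
  next
    case False
    then have bL: "1 < b * L" by simp
    then have L': "0 < L" using L by (cases "L = 0") auto
    \<comment> \<open>The linear bound is used up to \<open>s\<close>, the logarithmic one beyond.\<close>
    define s where "s = 1 / L"
    have s: "0 < s" "s < b" "L * s = 1" using bL L' by (simp_all add: s_def pos_divide_less_eq)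
    show ?thesis
    \<comment> \<open>Only the first summand grows below \<open>s\<close> and only the second above;
      up to \<open>s\<close> the first contributes exactly \<open>L * s = 1\<close>.\<close>
    proof (rule reduce[of "\<lambda>\<alpha>. L * min \<alpha> s + ln n * ln (max \<alpha> s)"])
      have "ln b - ln s = ln (b * L)" using L' order.strict_trans[OF s(1,2)] by (simp add: s_def ln_div ln_mult)
      then have "L * min b s + ln n * ln (max b s) - (L * min 0 s + ln n * ln (max 0 s)) =
          1 + ln n * ln (b * L)"
        using s by (simp add: right_diff_distrib[symmetric] algebra_simps)
      moreover have "0 \<le> ln n * ln (b * L)" using bL n by simp
      ultimately show "0 \<le> L * min b s + ln n * ln (max b s) - (L * min 0 s + ln n * ln (max 0 s))"
        "L * min b s + ln n * ln (max b s) - (L * min 0 s + ln n * ln (max 0 s))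
           \<le> (1 + 1 / (\<delta> * ln 2)) * (ln n * M)"
        using one(2) by auto
    next
      fix C i and \<alpha> \<beta> :: real assume C: "set C \<subseteq> V" "i \<le> card V" and \<alpha>: "0 \<le> \<alpha>" "\<alpha> \<le> \<beta>"
      let ?F = "threshold arr d C i"
      \<comment> \<open>For each exponent one of the minimum and the maximum with \<open>s\<close>
        is the exponent and the other is \<open>s\<close>, so the values at \<open>s\<close>
        cancel.\<close>
      have "?F \<beta> - ?F \<alpha> = (?F (min \<beta> s) - ?F (min \<alpha> s)) + (?F (max \<beta> s) - ?F (max \<alpha> s))"
        by (auto simp: min_def max_def)
      also have "\<dots> \<le> (L * min \<beta> s - L * min \<alpha> s) + (ln n * ln (max \<beta> s) - ln n * ln (max \<alpha> s))"
        unfolding n_def using C \<alpha> s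
        by (intro add_mono linear threshold_diff_le_ln) auto
      finally show "?F \<beta> - ?F \<alpha> \<le>
          L * min \<beta> s + ln n * ln (max \<beta> s) - (L * min \<alpha> s + ln n * ln (max \<alpha> s))"
        by simp
    qed
  qed
qed

end

text \<open>The constants precede the instance, as the O-notation demands; the witnesses are
  \<open>1\<close> and \<open>1 + 1 / (\<delta> * ln 2)\<close>. The floor \<open>\<delta>\<close>
  replaces the second logarithm where that is negative or close to \<open>0\<close>.\<close>

theorem theorem4:
  shows "(\<exists>c>0. \<forall>(V :: 'a set) d k arr \<alpha>l \<alpha>h.
            clustering_instance V d k \<longrightarrow> is_arrangement V d arr \<longrightarrow> 0 < \<alpha>l \<longrightarrow> \<alpha>l \<le> \<alpha>h \<longrightarrow>
            expected_at_most (uniform_cube k)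
              (\<lambda>Z. num_discontinuities (\<lambda>\<alpha>. seed arr d k \<alpha> Z) {\<alpha>l..\<alpha>h})
              (c * (real (card V) * real k * ln (real (card V)) * ln (\<alpha>h / \<alpha>l)))) \<and>
         (\<forall>\<delta>>0. \<exists>c>0. \<forall>(V :: 'a set) d k arr \<alpha>h.
            clustering_instance V d k \<longrightarrow> is_arrangement V d arr \<longrightarrow> 0 \<le> \<alpha>h \<longrightarrow>
            expected_at_most (uniform_cube k)
              (\<lambda>Z. num_discontinuities (\<lambda>\<alpha>. seed arr d k \<alpha> Z) {0..\<alpha>h})
              (c * (real (card V) * real k * ln (real (card V)) *
                    max \<delta> (ln (\<alpha>h * ln (max_dist_ratio V d))))))"
proof (intro conjI allI impI)
  show "\<exists>c>0. \<forall>(V :: 'a set) d k arr \<alpha>l \<alpha>h.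
            clustering_instance V d k \<longrightarrow> is_arrangement V d arr \<longrightarrow> 0 < \<alpha>l \<longrightarrow> \<alpha>l \<le> \<alpha>h \<longrightarrow>
            expected_at_most (uniform_cube k)
              (\<lambda>Z. num_discontinuities (\<lambda>\<alpha>. seed arr d k \<alpha> Z) {\<alpha>l..\<alpha>h})
              (c * (real (card V) * real k * ln (real (card V)) * ln (\<alpha>h / \<alpha>l)))"
  proof (intro exI[of _ 1] conjI allI impI)
    fix V :: "'a set" and d k arr and \<alpha>l \<alpha>h :: real
    assume inst: "clustering_instance V d k" "is_arrangement V d arr" and \<alpha>: "0 < \<alpha>l" "\<alpha>l \<le> \<alpha>h"
    interpret seeding V d k arr
      using inst by (intro seeding.intro seeding_axioms.intro)
    show "expected_at_most (uniform_cube k)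
        (\<lambda>Z. num_discontinuities (\<lambda>\<alpha>. seed arr d k \<alpha> Z) {\<alpha>l..\<alpha>h})
        (1 * (real (card V) * real k * ln (real (card V)) * ln (\<alpha>h / \<alpha>l)))"
      using expected_discontinuities_log[OF \<alpha>] by simp
  qed simp
next
  fix \<delta> :: real assume \<delta>: "0 < \<delta>"
  show "\<exists>c>0. \<forall>(V :: 'a set) d k arr \<alpha>h.
            clustering_instance V d k \<longrightarrow> is_arrangement V d arr \<longrightarrow> 0 \<le> \<alpha>h \<longrightarrow>
            expected_at_most (uniform_cube k)
              (\<lambda>Z. num_discontinuities (\<lambda>\<alpha>. seed arr d k \<alpha> Z) {0..\<alpha>h})
              (c * (real (card V) * real k * ln (real (card V)) *
                    max \<delta> (ln (\<alpha>h * ln (max_dist_ratio V d)))))"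
  proof (intro exI[of _ "1 + 1 / (\<delta> * ln 2)"] conjI allI impI)
    fix V :: "'a set" and d k arr and \<alpha>h :: real
    assume inst: "clustering_instance V d k" "is_arrangement V d arr" and \<alpha>: "0 \<le> \<alpha>h"
    interpret seeding V d k arr
      using inst by (intro seeding.intro seeding_axioms.intro)
    show "expected_at_most (uniform_cube k)
        (\<lambda>Z. num_discontinuities (\<lambda>\<alpha>. seed arr d k \<alpha> Z) {0..\<alpha>h})
        ((1 + 1 / (\<delta> * ln 2)) * (real (card V) * real k * ln (real (card V)) *
          max \<delta> (ln (\<alpha>h * ln (max_dist_ratio V d)))))"
      by (rule expected_discontinuities_from_0[OF \<delta> \<alpha>])
  qed (use \<delta> in \<open>auto intro!: add_pos_nonneg\<close>)
qed

end
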